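(* Let $n,d$ be positive integers and put $R=R^+(d,\{\pm1,\pm2,\dots,\pm n\})$. For $1\leq d\leq\log n$, \[\exp\left\{-\Theta\left(\frac{1}{n^{1/(2d)}}\right)\right\}\leq R<\exp\left\{-\frac{1}{n^{1/d}}\right\}.\] For $\log n<d<n$, $R=\exp\left\{-\Theta\left(\frac{d}{\log(2n/d)}\right)\right\}$. For $d\geq n$, $R=0$.
   Context: For an integer $d$ and a finite set $S\subset\mathbb{R}$, $R^+(d,S)=\inf_{p,q}\max_{t\in S}|\mathrm{sign}\,t-p(t)/q(t)|$, the infimum over univariate real polynomials $p,q$ of degree at most $d$ with $q$ positive on $S$. $\log$ is to base $2$. *)

theory Defs
  imports Complex_Main "HOL-Computational_Algebra.Polynomial"
begin

(* Meaningful for finite nonempty S; the Inf is then over a nonempty set bounded below by 0. *)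
definition Rplus :: "nat \<Rightarrow> real set \<Rightarrow> real" where
  "Rplus d S = Inf {Max ((\<lambda>t. \<bar>sgn t - poly p t / poly q t\<bar>) ` S) | p q :: real poly.
     degree p \<le> d \<and> degree q \<le> d \<and> (\<forall>t\<in>S. poly q t > 0)}"

definition pm_set :: "nat \<Rightarrow> real set" where
  "pm_set n = real ` {1..n} \<union> (\<lambda>i. - real i) ` {1..n}"

end

theory Submission
  imports Defs
begin

text \<open>
  Upper bounds: if \<open>|P(-t)| \<le> e P(t)\<close> on \<open>{1..n}\<close> with \<open>e < 1\<close>, then a multiple of
  \<open>(P(t) - P(-t)) / (P(t) + P(-t))\<close> approximates the sign with error \<open>2e / (1 + e\<^sup>2)\<close>.
  One chooses \<open>P\<close> with roots in geometric progression for small degrees, and with roots at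
  \<open>-1, ..., -d/2\<close> and at powers of two, with multiplicity, for large degrees.

  Lower bounds: an approximant \<open>p/q\<close> yields \<open>P(x) = p(x) - p(-x) + q(x) + q(-x)\<close> for which
  \<open>|P(-t)|\<close> is small compared with \<open>P(t)\<close>. Comparing \<open>P\<close> with a polynomial \<open>Z\<close> whose roots interlace
  \<open>d + 1\<close> chosen points \<open>- t i\<close> gives an odd polynomial of degree at most \<open>2d\<close> with too many sign
  changes. The resulting bound depends only on the least ratio \<open>1/r\<^sup>2\<close> of consecutive points and equals
  \<open>exp (- O(r / (1 - r\<^sup>2)))\<close>; for small degrees the points are the powers of \<open>\<lfloor>n powr (1/d)\<rfloor>\<close>,
  for large degrees the slowest growing sequence of integers with ratio at least \<open>1 + 1/h\<close>,
  where \<open>h\<close> is of order \<open>d / log (2n/d)\<close>.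
\<close>

section \<open>Sample points and elementary properties of the infimum\<close>

lemma mem_pm_set:
  "t \<in> pm_set n \<longleftrightarrow> (\<exists>i. 1 \<le> i \<and> i \<le> n \<and> (t = real i \<or> t = - real i))"
  by (auto simp: pm_set_def)

lemma finite_pm_set: "finite (pm_set n)"
  by (simp add: pm_set_def)

text \<open>The set under the infimum in \<open>Rplus\<close>, named so that order lemmas for
  \<open>Inf\<close> apply to it directly.\<close>

definition rat_errors :: "nat \<Rightarrow> real set \<Rightarrow> real set" where
  "rat_errors d S = {Max ((\<lambda>t. \<bar>sgn t - poly p t / poly q t\<bar>) ` S) | p q :: real poly.
     degree p \<le> d \<and> degree q \<le> d \<and> (\<forall>t\<in>S. poly q t > 0)}"

lemma Rplus_eq_Inf_rat_errors: "Rplus d S = Inf (rat_errors d S)"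
  by (simp add: Rplus_def rat_errors_def)

lemma rat_errors_nonempty: "rat_errors d S \<noteq> {}"
proof -
  have "Max ((\<lambda>t. \<bar>sgn t - poly 0 t / poly [:1:] t\<bar>) ` S) \<in> rat_errors d S"
    unfolding rat_errors_def by (intro CollectI exI[of _ "0::real poly"] exI[of _ "[:1::real:]"]) auto
  thus ?thesis by blast
qed

lemma rat_errors_nonneg:
  assumes "finite S" "S \<noteq> {}" "e \<in> rat_errors d S"
  shows "0 \<le> e"
proof -
  obtain t where t: "t \<in> S" using assms by blast
  obtain p q where e: "e = Max ((\<lambda>t. \<bar>sgn t - poly p t / poly q t\<bar>) ` S)"
    using assms unfolding rat_errors_def by blast
  have "0 \<le> \<bar>sgn t - poly p t / poly q t\<bar>" by simp
  also have "\<dots> \<le> e" unfolding e using assms t by (intro Max_ge) auto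
  finally show ?thesis .
qed

lemma Rplus_nonneg:
  assumes "finite S" "S \<noteq> {}"
  shows "0 \<le> Rplus d S"
  unfolding Rplus_eq_Inf_rat_errors
  using rat_errors_nonempty rat_errors_nonneg[OF assms] by (intro cInf_greatest)

lemma Rplus_le:
  assumes S: "finite S" "S \<noteq> {}" and deg: "degree p \<le> d" "degree q \<le> d"
    and q: "\<And>t. t \<in> S \<Longrightarrow> poly q t > 0"
    and e: "\<And>t. t \<in> S \<Longrightarrow> \<bar>sgn t - poly p t / poly q t\<bar> \<le> e"
  shows "Rplus d S \<le> e"
proof -
  let ?m = "Max ((\<lambda>t. \<bar>sgn t - poly p t / poly q t\<bar>) ` S)"
  have "?m \<in> rat_errors d S" unfolding rat_errors_def using deg q by blast
  moreover have "bdd_below (rat_errors d S)"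
    using rat_errors_nonneg[OF S] by (intro bdd_belowI)
  ultimately have "Rplus d S \<le> ?m"
    unfolding Rplus_eq_Inf_rat_errors by (intro cInf_lower)
  also have "\<dots> \<le> e" using S e by (intro Max.boundedI) auto
  finally show ?thesis .
qed

lemma degree_prod_linear_le:
  fixes f :: "'a \<Rightarrow> real"
  assumes "finite S"
  shows "degree (\<Prod>i\<in>S. [:f i, 1:]) \<le> card S"
  using degree_prod_sum_le[OF assms, of "\<lambda>i. [:f i, 1:]"] by simp

section \<open>Upper bounds\<close>

text \<open>On \<open>[-e, e]\<close> the map \<open>(1 - x) / (1 + x)\<close> decreases from
  \<open>(1 + e) / (1 - e)\<close> to its reciprocal. The prefactor turns these extremes into
  \<open>(1 + e)^2 / (1 + e^2)\<close> and \<open>(1 - e)^2 / (1 + e^2)\<close>, which are symmetric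
  about 1.\<close>

lemma mobius_error_bound:
  fixes x e :: real
  assumes "\<bar>x\<bar> \<le> e" "e < 1"
  shows "\<bar>1 - (1 - e\<^sup>2) / (1 + e\<^sup>2) * ((1 - x) / (1 + x))\<bar> \<le> 2 * e / (1 + e\<^sup>2)"
proof -
  have e0: "0 \<le> e" and x: "-e \<le> x" "x \<le> e" "0 < 1 + x" using assms by linarith+
  have pos: "1 + e\<^sup>2 > 0" by (smt (verit) zero_le_power2)
  have l: "(1 - e)\<^sup>2 * (1 + x) \<le> (1 - e\<^sup>2) * (1 - x)"
  proof -
    have "(1 - e\<^sup>2) * (1 - x) - (1 - e)\<^sup>2 * (1 + x) = 2 * ((1 - e) * (e - x))"
      by (simp add: power2_eq_square algebra_simps)
    moreover have "0 \<le> (1 - e) * (e - x)" using assms x by (intro mult_nonneg_nonneg) linarith+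
    ultimately show ?thesis by linarith
  qed
  have u: "(1 - e\<^sup>2) * (1 - x) \<le> (1 + e)\<^sup>2 * (1 + x)"
  proof -
    have "(1 + e)\<^sup>2 * (1 + x) - (1 - e\<^sup>2) * (1 - x) = 2 * ((1 + e) * (e + x))"
      by (simp add: power2_eq_square algebra_simps)
    moreover have "0 \<le> (1 + e) * (e + x)" using e0 x by (intro mult_nonneg_nonneg) linarith+
    ultimately show ?thesis by linarith
  qed
  have eq: "1 - (1 - e\<^sup>2) / (1 + e\<^sup>2) * ((1 - x) / (1 + x))
      = ((1 + e\<^sup>2) * (1 + x) - (1 - e\<^sup>2) * (1 - x)) / ((1 + e\<^sup>2) * (1 + x))"
    using pos x
    unfolding times_divide_times_eq diff_divide_distrib[of _ _ "(1 + e\<^sup>2) * (1 + x)"] by simp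
  have eq2: "2 * e / (1 + e\<^sup>2) = 2 * e * (1 + x) / ((1 + e\<^sup>2) * (1 + x))"
    using pos x by simp
  have "\<bar>(1 + e\<^sup>2) * (1 + x) - (1 - e\<^sup>2) * (1 - x)\<bar> \<le> 2 * e * (1 + x)"
    using l u by (intro abs_leI) (simp_all add: power2_eq_square algebra_simps)
  hence "\<bar>(1 + e\<^sup>2) * (1 + x) - (1 - e\<^sup>2) * (1 - x)\<bar> / ((1 + e\<^sup>2) * (1 + x))
      \<le> 2 * e * (1 + x) / ((1 + e\<^sup>2) * (1 + x))"
    using pos x by (intro divide_right_mono) auto
  thus ?thesis unfolding eq eq2 abs_divide using pos x by (simp only: abs_mult abs_of_pos)
qed

text \<open>
  Newman's rational function built from \<open>P\<close>, rescaled so that its values on the positive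
  points, which fill \<open>[(1-e)/(1+e), (1+e)/(1-e)]\<close>, become centred at \<open>1\<close>.
\<close>

lemma Rplus_pm_set_le:
  fixes P :: "real poly"
  assumes n: "1 \<le> n" and deg: "degree P \<le> d" and e: "0 \<le> e" "e < 1"
    and pos: "\<And>i. 1 \<le> i \<Longrightarrow> i \<le> n \<Longrightarrow> 0 < poly P (real i)"
    and bound: "\<And>i. 1 \<le> i \<Longrightarrow> i \<le> n \<Longrightarrow> \<bar>poly P (- real i)\<bar> \<le> e * poly P (real i)"
  shows "Rplus d (pm_set n) \<le> 2 * e / (1 + e\<^sup>2)"
proof -
  define Q where "Q = pcompose P [:0, -1:]"
  have Q: "poly Q x = poly P (- x)" for x by (simp add: Q_def poly_pcompose)
  have degQ: "degree Q \<le> d" using degree_pcompose_le[of P "[:0,-1:]"] deg by (simp add: Q_def)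
  define c where "c = (1 - e\<^sup>2) / (1 + e\<^sup>2)"
  have key: "0 < poly P (real i) + poly P (- real i) \<and>
      \<bar>1 - c * (poly P (real i) - poly P (- real i)) / (poly P (real i) + poly P (- real i))\<bar>
        \<le> 2 * e / (1 + e\<^sup>2)" if i: "1 \<le> i" "i \<le> n" for i
  proof -
    \<comment> \<open>The quotient depends on \<open>P\<close> only through this ratio, which lies
      in \<open>[-e, e]\<close>.\<close>
    define x where "x = poly P (- real i) / poly P (real i)"
    have p: "0 < poly P (real i)" using pos i by blast
    have x: "\<bar>x\<bar> \<le> e" using bound[OF i] p by (simp add: x_def abs_divide divide_le_eq)
    have Pm: "poly P (- real i) = x * poly P (real i)" using p by (simp add: x_def)
    have "0 < 1 + x" using x e by linarith
    hence "0 < (1 + x) * poly P (real i)" using p by simp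
    moreover have "c * (poly P (real i) - poly P (- real i)) / (poly P (real i) + poly P (- real i))
        = c * ((1 - x) / (1 + x))"
    proof -
      have "poly P (real i) - poly P (- real i) = (1 - x) * poly P (real i)"
           "poly P (real i) + poly P (- real i) = (1 + x) * poly P (real i)"
        by (simp_all add: Pm algebra_simps)
      thus ?thesis using p by simp
    qed
    ultimately show ?thesis using mobius_error_bound[OF x e(2)]
      by (simp add: c_def Pm algebra_simps)
  qed
  show ?thesis
  proof (rule Rplus_le)
    show "degree (smult c (P - Q)) \<le> d" "degree (P + Q) \<le> d"
      using deg degQ by (auto intro: order_trans[OF degree_smult_le] degree_diff_le degree_add_le)
    show "pm_set n \<noteq> {}" using n by (auto simp: pm_set_def)
  next
    fix t assume "t \<in> pm_set n"
    then obtain i where i: "1 \<le> i" "i \<le> n" and t: "t = real i \<or> t = - real i"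
      by (auto simp: mem_pm_set)
    show "0 < poly (P + Q) t" using key[OF i] t by (auto simp: Q add.commute)
    show "\<bar>sgn t - poly (smult c (P - Q)) t / poly (P + Q) t\<bar> \<le> 2 * e / (1 + e\<^sup>2)"
    proof (cases "t = real i")
      case True
      thus ?thesis using key[OF i] i by (simp add: Q)
    next
      case False
      hence t: "t = - real i" using t by simp
      \<comment> \<open>\<open>P - Q\<close> is odd and \<open>P + Q\<close> is even, so the error
        at \<open>-i\<close> is the negative of the error at \<open>i\<close>.\<close>
      have "sgn t - poly (smult c (P - Q)) t / poly (P + Q) t
          = - (1 - c * (poly P (real i) - poly P (- real i)) / (poly P (real i) + poly P (- real i)))"
        using i unfolding t by (simp add: Q add.commute minus_divide_left algebra_simps)
      thus ?thesis using key[OF i] by (simp only: abs_minus_cancel)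
    qed
  qed (rule finite_pm_set)
qed

text \<open>Degree \<open>n\<close> suffices for a zero at every \<open>-i\<close>, so the general
  bound applies with \<open>e = 0\<close>.\<close>

lemma Rplus_eq_0:
  assumes "1 \<le> n" "n \<le> d"
  shows "Rplus d (pm_set n) = 0"
proof (rule antisym)
  define P :: "real poly" where "P = (\<Prod>i\<in>{1..n}. [:real i, 1:])"
  have P: "poly P x = (\<Prod>i\<in>{1..n}. real i + x)" for x by (simp add: P_def poly_prod)
  have "Rplus d (pm_set n) \<le> 2 * 0 / (1 + 0\<^sup>2)"
  proof (rule Rplus_pm_set_le[of n P])
    show "degree P \<le> d"
      using degree_prod_linear_le[of "{1..n}" real] assms by (simp add: P_def)
    fix i assume i: "1 \<le> i" "i \<le> n"
    show "0 < poly P (real i)" unfolding P by (intro prod_pos) auto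
    have "poly P (- real i) = 0" unfolding P using i by (intro prod_zero) auto
    thus "\<bar>poly P (- real i)\<bar> \<le> 0 * poly P (real i)" by simp
  qed (use assms in auto)
  thus "Rplus d (pm_set n) \<le> 0" by simp
  show "0 \<le> Rplus d (pm_set n)"
    using assms by (intro Rplus_nonneg) (auto simp: pm_set_def)
qed

lemma between_powers:
  fixes s x :: real
  assumes "1 \<le> x" "x \<le> s ^ m" "1 \<le> m"
  shows "\<exists>j<m. s ^ j \<le> x \<and> x \<le> s ^ Suc j"
  using assms(3,2)
proof (induction m rule: dec_induct)
  case base
  thus ?case using assms(1) by auto
next
  case (step m)
  show ?case
  proof (cases "x \<le> s ^ m")
    case True
    thus ?thesis using step.IH less_Suc_eq by blast
  next
    case False
    thus ?thesis using step.prems by (intro exI[of _ m]) auto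
  qed
qed

text \<open>The blocks \<open>[s^j, s^(j+1)]\<close> with \<open>j < d\<close> cover
  \<open>[1, n]\<close>, and the roots of \<open>P\<close> are minus their geometric midpoints.
  Every \<open>i\<close> is within a factor \<open>r = sqrt s\<close> of some midpoint, and that one
  factor of \<open>P\<close> already gives the ratio \<open>(r - 1) / (r + 1)\<close>.\<close>

lemma Rplus_le_geometric:
  assumes n: "2 \<le> n" and d: "1 \<le> d"
  defines "s \<equiv> real n powr (1 / real d)"
  shows "Rplus d (pm_set n) \<le> (s - 1) / (s + 1)" "1 < s"
proof -
  show s1: "1 < s" unfolding s_def using n d by simp
  have sd: "s ^ d = real n" unfolding s_def using n d by (simp add: powr_power)
  define r where "r = sqrt s"
  have r1: "1 < r" and rs: "r * r = s" using s1 by (simp_all add: r_def)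
  define P :: "real poly" where "P = (\<Prod>j<d. [:r * s ^ j, 1:])"
  have P: "poly P x = (\<Prod>j<d. r * s ^ j + x)" for x by (simp add: P_def poly_prod)
  define e where "e = (r - 1) / (r + 1)"
  have e: "0 \<le> e" "e < 1" using r1 by (simp_all add: e_def)
  have a0: "0 < r * s ^ j" for j using r1 s1 by simp
  have "Rplus d (pm_set n) \<le> 2 * e / (1 + e\<^sup>2)"
  proof (rule Rplus_pm_set_le[of n P])
    show "degree P \<le> d"
      using degree_prod_linear_le[of "{..<d}" "\<lambda>j. r * s ^ j"] by (simp add: P_def)
    fix i assume i: "1 \<le> i" "i \<le> n"
    show "0 < poly P (real i)" unfolding P using a0 by (intro prod_pos) (simp add: add_pos_nonneg)
    obtain j where j: "j < d" "s ^ j \<le> real i" "real i \<le> s ^ Suc j"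
      using between_powers[of "real i" s d] i d sd by auto
    define a where "a = r * s ^ j"
    have ai: "a \<le> r * real i" "real i \<le> r * a" "0 < a"
      using j r1 a0 by (auto simp: a_def simp flip: rs)
    have "\<bar>a - real i\<bar> * (r + 1) \<le> (r - 1) * (a + real i)"
      using ai by (cases "a \<le> real i") (simp_all add: algebra_simps)
    hence near: "\<bar>a - real i\<bar> \<le> e * (a + real i)"
      using r1 by (simp add: e_def field_simps)
    \<comment> \<open>All other roots are negative, so their factors do not increase under
      reflection.\<close>
    have far: "(\<Prod>j\<in>{..<d} - {j}. \<bar>r * s ^ j - real i\<bar>) \<le> (\<Prod>j\<in>{..<d} - {j}. r * s ^ j + real i)"
    proof (intro prod_mono conjI)
      fix l
      show "\<bar>r * s ^ l - real i\<bar> \<le> r * s ^ l + real i" using a0[of l] by linarith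
    qed simp
    have "\<bar>poly P (- real i)\<bar> = \<bar>a - real i\<bar> * (\<Prod>j\<in>{..<d} - {j}. \<bar>r * s ^ j - real i\<bar>)"
      using j by (simp add: P abs_prod abs_mult a_def prod.remove[of _ j])
    also have "\<dots> \<le> e * (a + real i) * (\<Prod>j\<in>{..<d} - {j}. r * s ^ j + real i)"
      using near far e ai by (intro mult_mono) (auto intro: prod_nonneg)
    also have "\<dots> = e * poly P (real i)"
      using j by (simp add: P a_def prod.remove[of _ j])
    finally show "\<bar>poly P (- real i)\<bar> \<le> e * poly P (real i)" .
  qed (use e n in auto)
  \<comment> \<open>This is the doubling formula for tanh: \<open>e\<close> is the tanh of
    \<open>ln r / 2\<close>, and \<open>r^2 = s\<close>.\<close>
  also have "2 * e / (1 + e\<^sup>2) = (s - 1) / (s + 1)"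
  proof -
    have "(r + 1)\<^sup>2 + (r - 1)\<^sup>2 = 2 * (s + 1)" "(r - 1) * (r + 1) = s - 1"
      by (simp_all add: power2_eq_square algebra_simps flip: rs)
    moreover have "1 + e\<^sup>2 = ((r + 1)\<^sup>2 + (r - 1)\<^sup>2) / (r + 1)\<^sup>2"
      using r1 by (simp add: e_def power_divide add_divide_distrib)
    moreover have "2 * e = 2 * ((r - 1) * (r + 1)) / (r + 1)\<^sup>2"
      using r1 by (simp add: e_def power2_eq_square)
    ultimately have "1 + e\<^sup>2 = (s + 1) * (2 / (r + 1)\<^sup>2)" "2 * e = (s - 1) * (2 / (r + 1)\<^sup>2)"
      by simp_all
    moreover have c: "2 / (r + 1)\<^sup>2 \<noteq> 0" using r1 by simp
    ultimately show ?thesis by (simp only: mult_divide_mult_cancel_right[OF c])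
  qed
  finally show "Rplus d (pm_set n) \<le> (s - 1) / (s + 1)" .
qed

text \<open>Strictness comes from replacing the denominator \<open>s + 1\<close> by
  \<open>s\<close>, which leaves \<open>1 - 1/s\<close>.\<close>

lemma Rplus_less_exp:
  assumes "2 \<le> n" "1 \<le> d"
  shows "Rplus d (pm_set n) < exp (- (1 / real n powr (1 / real d)))"
proof -
  define s where "s = real n powr (1 / real d)"
  have s: "Rplus d (pm_set n) \<le> (s - 1) / (s + 1)" "1 < s"
    using Rplus_le_geometric[OF assms] by (simp_all add: s_def)
  note s(1)
  also have "(s - 1) / (s + 1) < (s - 1) / s" using s(2) by (intro divide_strict_left_mono) auto
  also have "\<dots> = 1 + - (1 / s)" using s(2) by (simp add: field_simps)
  also have "\<dots> \<le> exp (- (1 / s))" by (rule exp_ge_add_one_self)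
  finally show ?thesis by (simp add: s_def)
qed

text \<open>
  The first half of the zeros sits on the smallest points; the other half is spread with equal
  multiplicity over the dyadic scales above them.
\<close>

lemma Rplus_le_dyadic:
  assumes h: "1 \<le> h" "h \<le> n" and n: "n \<le> h * 2 ^ J" and J: "1 \<le> J" and k: "1 \<le> k"
    and d: "h + k * J \<le> d"
  shows "Rplus d (pm_set n) \<le> 2 * (1 / 3) ^ k"
proof -
  define A :: "real poly" where "A = (\<Prod>i\<in>{1..h}. [:real i, 1:])"
  define B :: "real poly" where "B = (\<Prod>j<J. [:real h * 2 ^ j, 1:])"
  have A: "poly A x = (\<Prod>i\<in>{1..h}. real i + x)" for x by (simp add: A_def poly_prod)
  have B: "poly B x = (\<Prod>j<J. real h * 2 ^ j + x)" for x by (simp add: B_def poly_prod)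
  define e :: real where "e = (1 / 3) ^ k"
  have e: "0 \<le> e" "e < 1" using k by (simp_all add: e_def power_less_one_iff)
  have "Rplus d (pm_set n) \<le> 2 * e / (1 + e\<^sup>2)"
  proof (rule Rplus_pm_set_le[of n "A * B ^ k"])
    have "degree A \<le> h"
      using degree_prod_linear_le[of "{1..h}" real] by (simp add: A_def)
    moreover have "degree B \<le> J"
      using degree_prod_linear_le[of "{..<J}" "\<lambda>j. real h * 2 ^ j"] by (simp add: B_def)
    moreover have "degree (A * B ^ k) \<le> degree A + degree B * k"
      by (rule order_trans[OF degree_mult_le]) (simp add: degree_power_le)
    moreover have "degree B * k \<le> J * k" using calculation by (intro mult_right_mono) auto
    ultimately have "degree (A * B ^ k) \<le> h + J * k" by linarith
    thus "degree (A * B ^ k) \<le> d" using d by (simp add: mult.commute)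
    fix i assume i: "1 \<le> i" "i \<le> n"
    have Apos: "0 < poly A (real i)" unfolding A by (intro prod_pos) auto
    have Bpos: "0 < poly B (real i)" unfolding B using h by (intro prod_pos) (auto intro: add_pos_nonneg)
    show "0 < poly (A * B ^ k) (real i)" using Apos Bpos by simp
    show "\<bar>poly (A * B ^ k) (- real i)\<bar> \<le> e * poly (A * B ^ k) (real i)"
    proof (cases "i \<le> h")
      case True
      hence "poly A (- real i) = 0" unfolding A using i by (intro prod_zero) auto
      thus ?thesis using e Apos Bpos by simp
    next
      case False
      have "real n \<le> real h * 2 ^ J" using n by (metis of_nat_le_iff of_nat_mult of_nat_numeral of_nat_power)
      hence "real i / real h \<le> 2 ^ J" "1 \<le> real i / real h"
        using False h i by (simp_all add: field_simps)
      then obtain j where j: "j < J" "2 ^ j \<le> real i / real h" "real i / real h \<le> 2 ^ Suc j"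
        using between_powers J by blast
      define a where "a = real h * 2 ^ j"
      have a: "a \<le> real i" "real i \<le> 2 * a" "0 < a"
        using j h by (simp_all add: a_def field_simps)
      \<comment> \<open>Two numbers within a factor 2 have \<open>|a - i| / (a + i)\<close> at most
        \<open>(2 - 1) / (2 + 1)\<close>; the multiplicity \<open>k\<close> raises this to the power
        \<open>k\<close>.\<close>
      have near: "\<bar>a - real i\<bar> \<le> 1 / 3 * (a + real i)" using a by (simp add: field_simps)
      have far: "(\<Prod>j\<in>{..<J} - {j}. \<bar>real h * 2 ^ j - real i\<bar>)
          \<le> (\<Prod>j\<in>{..<J} - {j}. real h * 2 ^ j + real i)"
      proof (intro prod_mono conjI)
        fix l
        have "0 \<le> real h * 2 ^ l" by simp
        thus "\<bar>real h * 2 ^ l - real i\<bar> \<le> real h * 2 ^ l + real i" by linarith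
      qed simp
      have "\<bar>poly B (- real i)\<bar> = \<bar>a - real i\<bar> * (\<Prod>j\<in>{..<J} - {j}. \<bar>real h * 2 ^ j - real i\<bar>)"
        using j by (simp add: B abs_prod abs_mult a_def prod.remove[of _ j])
      also have "\<dots> \<le> 1 / 3 * (a + real i) * (\<Prod>j\<in>{..<J} - {j}. real h * 2 ^ j + real i)"
        using near far a by (intro mult_mono) (auto intro: prod_nonneg)
      also have "\<dots> = 1 / 3 * poly B (real i)"
        using j by (simp add: B a_def prod.remove[of _ j])
      finally have "\<bar>poly B (- real i)\<bar> ^ k \<le> (1 / 3 * poly B (real i)) ^ k"
        by (intro power_mono) auto
      hence Bk: "\<bar>poly B (- real i)\<bar> ^ k \<le> e * poly B (real i) ^ k"
        by (simp add: e_def power_mult_distrib power_one_over field_simps)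
      have "\<bar>poly A (- real i)\<bar> \<le> poly A (real i)"
        unfolding A abs_prod by (intro prod_mono) auto
      hence "\<bar>poly A (- real i)\<bar> * \<bar>poly B (- real i)\<bar> ^ k \<le> poly A (real i) * (e * poly B (real i) ^ k)"
        using Bk Apos by (intro mult_mono) auto
      thus ?thesis by (simp add: abs_mult power_abs mult_ac)
    qed
  qed (use e h in auto)
  also have "\<dots> \<le> 2 * e" using e by (intro divide_le_eq[THEN iffD2]) (auto simp: mult_le_cancel_left1 add_pos_nonneg)
  finally show ?thesis by (simp add: e_def)
qed

section \<open>Lower bounds\<close>

text \<open>The \<open>d\<close> sign changes give \<open>d\<close> positive roots; their
  reflections and 0 raise the count to \<open>2d + 1\<close>. Nonvanishing at \<open>t 0\<close>
  excludes \<open>F = 0\<close> even when \<open>d = 0\<close>.\<close>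

lemma odd_poly_no_alternation:
  fixes F :: "real poly" and t :: "nat \<Rightarrow> real"
  assumes odd: "\<And>x. poly F (- x) = - poly F x" and deg: "degree F \<le> 2 * d"
    and t0: "0 < t 0" and t: "\<And>i. i < d \<Longrightarrow> t i < t (Suc i)"
    and alt: "\<And>i. i < d \<Longrightarrow> poly F (t i) * poly F (t (Suc i)) < 0"
    and nz: "poly F (t 0) \<noteq> 0"
  shows False
proof -
  have "\<exists>x. t i < x \<and> x < t (Suc i) \<and> poly F x = 0" if "i < d" for i
    using poly_IVT[OF t alt] that by blast
  then obtain \<rho> where \<rho>: "t i < \<rho> i" "\<rho> i < t (Suc i)" "poly F (\<rho> i) = 0" if "i < d" for i
    by metis
  have mono: "t i \<le> t j" if "i \<le> j" "j \<le> d" for i j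
    using that
  proof (induction j rule: dec_induct)
    case (step j)
    thus ?case using t[of j] by simp
  qed simp
  have less: "\<rho> i < \<rho> j" if "i < j" "j < d" for i j
    using \<rho>[of i] \<rho>[of j] mono[of "Suc i" j] that by simp
  hence inj: "inj_on \<rho> {..<d}"
    by (intro inj_onI) (metis lessThan_iff less_irrefl linorder_neqE_nat)
  have pos: "0 < \<rho> i" if "i < d" for i
    using \<rho>[OF that] mono[of 0 i] t0 that by simp
  define X where "X = \<rho> ` {..<d}"
  have X: "finite X" "card X = d" "x \<in> X \<Longrightarrow> 0 < x" "x \<in> X \<Longrightarrow> poly F x = 0" for x
    using card_image[OF inj] pos \<rho>(3) by (auto simp: X_def)
  have "y \<in> uminus ` X \<Longrightarrow> y < 0" for y using X(3) by auto
  hence "X \<inter> uminus ` X = {}" "0 \<notin> X \<union> uminus ` X"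
    using X(3) less_asym by blast+
  hence "card (insert 0 (X \<union> uminus ` X)) = Suc (2 * d)"
    using X(1,2) by (simp add: card_Un_disjoint card_image)
  moreover have "insert 0 (X \<union> uminus ` X) \<subseteq> {x. poly F x = 0}"
    using X(4) odd odd[of 0] by auto
  moreover have "F \<noteq> 0" using nz by auto
  ultimately have "Suc (2 * d) \<le> degree F"
    by (metis card_mono card_poly_roots_bound order_trans poly_roots_finite)
  thus False using deg by simp
qed

text \<open>The left side is \<open>(C / B)^2\<close>, and \<open>C - B <= 2x\<close> because
  \<open>C^2 - B^2 = 2x\<close> and \<open>C + B >= 1\<close>. The square root in the exponent
  matters: with the simpler exponent \<open>2x / (1 - x)\<close>, summing over many odd powers of
  \<open>r\<close> near 1 would cost an extra logarithm.\<close>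

lemma ratio_le_exp:
  fixes x :: real
  assumes "0 \<le> x" "x < 1"
  shows "(1 + x) / (1 - x) \<le> exp (4 * x / sqrt (1 - x))"
proof -
  define B C where "B = sqrt (1 - x)" and "C = sqrt (1 + x)"
  have B: "0 < B" "B\<^sup>2 = 1 - x" and C: "1 \<le> C" "C\<^sup>2 = 1 + x"
    using assms by (simp_all add: B_def C_def)
  have BC: "B \<le> C" using assms by (simp add: B_def C_def)
  have "(C - B) * 1 \<le> (C - B) * (C + B)" using B C BC by (intro mult_left_mono) auto
  also have "\<dots> = C\<^sup>2 - B\<^sup>2" by (simp add: power2_eq_square algebra_simps)
  finally have CB: "C - B \<le> 2 * x" using B C by simp
  have "C / B \<le> exp (C / B - 1)" using exp_ge_add_one_self[of "C / B - 1"] by simp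
  also have "C / B - 1 = (C - B) / B" using B by (simp add: field_simps)
  also have "exp \<dots> \<le> exp (2 * x / B)" using CB B by (simp add: divide_right_mono)
  finally have "(C / B)\<^sup>2 \<le> (exp (2 * x / B))\<^sup>2" using B C by (intro power_mono) auto
  also have "\<dots> = exp (4 * x / B)" by (simp add: power2_eq_square flip: exp_add)
  finally show ?thesis using B C by (simp add: power_divide B_def)
qed

text \<open>
  The summand is at most \<open>3/(1-r\<^sup>2)\<close> times an increment of \<open>k \<mapsto> sqrt (1 - r^(2k+1))\<close>,
  so the sum telescopes.
\<close>

lemma sum_odd_powers_le:
  fixes r :: real
  assumes r: "0 < r" "r < 1"
  shows "(\<Sum>k<N. 4 * r ^ (2 * k + 1) / sqrt (1 - r ^ (2 * k + 1))) \<le> 12 * r / (1 - r\<^sup>2)"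
proof -
  define x where "x k = r ^ (2 * k + 1)" for k
  have x: "0 < x k" "x k \<le> r" "x k < 1" "x (Suc k) = r\<^sup>2 * x k" for k
  proof -
    show "0 < x k" using r by (simp add: x_def)
    show "x k \<le> r" using r by (simp add: x_def mult_left_le power_le_one)
    thus "x k < 1" using r by simp
    show "x (Suc k) = r\<^sup>2 * x k" by (simp add: x_def power2_eq_square mult_ac)
  qed
  have r2: "0 < 1 - r\<^sup>2" using r by (simp add: power_less_one_iff)
  have step: "(1 - r\<^sup>2) * (x k / sqrt (1 - x k)) \<le> 3 * (sqrt (1 - x (Suc k)) - sqrt (1 - x k))" for k
  proof -
    define A B where "A = sqrt (1 - x (Suc k))" and "B = sqrt (1 - x k)"
    have A: "0 < A" "A\<^sup>2 = 1 - r\<^sup>2 * x k" and B: "0 < B" "B\<^sup>2 = 1 - x k"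
      using x[of k] x(3)[of "Suc k"] by (simp_all add: A_def B_def)
    have AB: "A\<^sup>2 - B\<^sup>2 = (1 - r\<^sup>2) * x k" unfolding A B by (simp add: algebra_simps)
    hence "B\<^sup>2 \<le> A\<^sup>2" using r2 x(1)[of k] by (smt (verit) mult_pos_pos)
    hence BA: "B \<le> A" using A by (intro power2_le_imp_le[of B A]) auto
    \<comment> \<open>This is \<open>A^2 <= 3 B^2\<close> rearranged. The worst case
      \<open>x k = r\<close> amounts to \<open>2 - 3r + r^3 >= 0\<close>. It yields
      \<open>A + B <= 3B\<close>, the source of the constant 3.\<close>
    have "x k * (3 - r\<^sup>2) \<le> r * (3 - r\<^sup>2)" using x r2 by (intro mult_right_mono) auto
    also have "\<dots> \<le> 2"
    proof -
      have "2 - r * (3 - r\<^sup>2) = (1 - r)\<^sup>2 * (r + 2)" by (simp add: power2_eq_square algebra_simps)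
      moreover have "0 \<le> (1 - r)\<^sup>2 * (r + 2)" using r by simp
      ultimately show ?thesis by linarith
    qed
    finally have "A\<^sup>2 \<le> 3 * B\<^sup>2" unfolding A B by (simp add: algebra_simps)
    hence "A\<^sup>2 \<le> 4 * B\<^sup>2" using zero_le_power2[of B] by linarith
    hence "A\<^sup>2 \<le> (2 * B)\<^sup>2" by (simp add: power_mult_distrib)
    hence "A \<le> 2 * B" using B by (intro power2_le_imp_le[of A]) auto
    hence "(A - B) * (A + B) \<le> (A - B) * (3 * B)" using BA by (intro mult_left_mono) auto
    hence "A\<^sup>2 - B\<^sup>2 \<le> 3 * (A - B) * B" by (simp add: power2_eq_square algebra_simps)
    hence "(A\<^sup>2 - B\<^sup>2) / B \<le> 3 * (A - B)" using B by (simp add: divide_le_eq)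
    thus ?thesis unfolding AB by (simp add: A_def B_def)
  qed
  have "(1 - r\<^sup>2) * (\<Sum>k<N. x k / sqrt (1 - x k))
      \<le> (\<Sum>k<N. 3 * (sqrt (1 - x (Suc k)) - sqrt (1 - x k)))"
    unfolding sum_distrib_left by (intro sum_mono step)
  also have "\<dots> = 3 * (sqrt (1 - x N) - sqrt (1 - x 0))"
    unfolding sum_distrib_left[symmetric] using sum_lessThan_telescope[of "\<lambda>k. sqrt (1 - x k)" N]
    by simp
  also have "\<dots> \<le> 3 * r"
  proof -
    \<comment> \<open>Bounding the telescoped difference by \<open>r\<close> instead of 1 keeps the
      estimate sharp for small \<open>r\<close>, as small degrees require.\<close>
    have "(1 - r)\<^sup>2 \<le> 1 - r" using r by (simp add: power2_eq_square mult_left_le)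
    hence "1 - r \<le> sqrt (1 - r)" by (rule real_le_rsqrt)
    hence "1 - r \<le> sqrt (1 - x 0)" by (simp add: x_def)
    moreover have "sqrt (1 - x N) \<le> 1" using x(1)[of N] by simp
    ultimately have "sqrt (1 - x N) - sqrt (1 - x 0) \<le> r" by linarith
    thus ?thesis by (intro mult_left_mono) auto
  qed
  finally have "(\<Sum>k<N. x k / sqrt (1 - x k)) \<le> 3 * r / (1 - r\<^sup>2)"
    using r2 by (simp add: pos_le_divide_eq mult.commute)
  hence "4 * (\<Sum>k<N. x k / sqrt (1 - x k)) \<le> 12 * r / (1 - r\<^sup>2)" by simp
  thus ?thesis by (simp add: x_def sum_distrib_left)
qed

text \<open>Going from \<open>t i\<close> to an adjacent \<open>z\<close> changes the size by a
  factor of at least \<open>1/r\<close>, and each further step by at least \<open>1/r^2\<close>.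
  Thus each side of \<open>t i\<close> contributes a sum over distinct odd powers of
  \<open>r\<close>, at most \<open>12 r / (1 - r^2)\<close>.\<close>

lemma interlacing_prod_bound:
  fixes t z :: "nat \<Rightarrow> real"
  assumes r: "0 < r" "r < 1" and t0: "\<And>i. 0 < t i"
    and t: "\<And>i. i < d \<Longrightarrow> t i \<le> r\<^sup>2 * t (Suc i)"
    and z: "\<And>i. i < d \<Longrightarrow> t i \<le> r * z i" "\<And>i. i < d \<Longrightarrow> z i \<le> r * t (Suc i)" "\<And>i. 0 < z i"
    and i: "i \<le> d"
  shows "(\<Prod>j<d. z j + t i) \<le> exp (24 * r / (1 - r\<^sup>2)) * (\<Prod>j<d. \<bar>z j - t i\<bar>)"
proof -
  define f where "f k = 4 * r ^ (2 * k + 1) / sqrt (1 - r ^ (2 * k + 1))" for k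
  have chain: "t a \<le> r ^ (2 * (b - a)) * t b" if "a \<le> b" "b \<le> d" for a b
    using that
  proof (induction b rule: dec_induct)
    case (step b)
    have "t a \<le> r ^ (2 * (b - a)) * t b" using step by simp
    also have "\<dots> \<le> r ^ (2 * (b - a)) * (r\<^sup>2 * t (Suc b))"
      using t[of b] step r by (intro mult_left_mono) auto
    also have "\<dots> = r ^ (2 * (Suc b - a)) * t (Suc b)"
      using step by (simp add: Suc_diff_le power2_eq_square mult_ac)
    finally show ?case .
  qed simp
  have pair: "a + b \<le> exp (f k) * (b - a)" if ab: "0 < b" "a \<le> r ^ (2 * k + 1) * b" for a b k
  proof -
    define x where "x = r ^ (2 * k + 1)"
    have x: "0 \<le> x" "x < 1" using r by (auto simp: x_def power_less_one_iff simp del: power_Suc)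
    have ab': "a \<le> x * b" using ab by (simp add: x_def)
    have "x * b \<le> 1 * b" using x ab by (intro mult_right_mono) auto
    hence "0 \<le> b - a" using ab' by linarith
    have "(a + b) * (1 - x) \<le> (1 + x) * (b - a)" using ab' by (simp add: algebra_simps)
    hence "a + b \<le> (1 + x) / (1 - x) * (b - a)" using x by (simp add: field_simps)
    also have "\<dots> \<le> exp (f k) * (b - a)"
      using ratio_le_exp[OF x] \<open>0 \<le> b - a\<close> by (intro mult_right_mono) (simp_all add: f_def x_def)
    finally show ?thesis .
  qed
  \<comment> \<open>The number of whole steps between \<open>z j\<close> and \<open>t i\<close>. On
    the left it is counted from \<open>t (Suc j)\<close>, the upper neighbour of
    \<open>z j\<close>.\<close>
  define \<kappa> where "\<kappa> j = (if j < i then i - Suc j else j - i)" for j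
  have factor: "z j + t i \<le> exp (f (\<kappa> j)) * \<bar>z j - t i\<bar>" if j: "j < d" for j
  proof (cases "j < i")
    case True
    have "z j \<le> r * t (Suc j)" using z j by blast
    also have "\<dots> \<le> r * (r ^ (2 * (i - Suc j)) * t i)"
      using chain[of "Suc j" i] True i r by (intro mult_left_mono) auto
    finally have "z j + t i \<le> exp (f (i - Suc j)) * (t i - z j)"
      using t0 by (intro pair) (auto simp: mult_ac)
    also have "\<dots> \<le> exp (f (i - Suc j)) * \<bar>z j - t i\<bar>" by (intro mult_left_mono) auto
    finally show ?thesis using True by (simp add: \<kappa>_def)
  next
    case False
    have "t i \<le> r ^ (2 * (j - i)) * t j" using chain[of i j] False j by simp
    also have "\<dots> \<le> r ^ (2 * (j - i)) * (r * z j)" using z j r by (intro mult_left_mono) auto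
    finally have "t i + z j \<le> exp (f (j - i)) * (z j - t i)"
      using z by (intro pair) (auto simp: mult_ac)
    also have "\<dots> \<le> exp (f (j - i)) * \<bar>z j - t i\<bar>" by (intro mult_left_mono) auto
    finally show ?thesis using False by (simp add: \<kappa>_def add.commute)
  qed
  have "(\<Sum>j<d. f (\<kappa> j)) = (\<Sum>j=0..<i. f (\<kappa> j)) + (\<Sum>j=i..<d. f (\<kappa> j))"
    using i by (simp add: sum.atLeastLessThan_concat flip: atLeast0LessThan)
  also have "(\<Sum>j=0..<i. f (\<kappa> j)) = (\<Sum>j<i. f (i - Suc j))"
    by (intro sum.cong) (auto simp: \<kappa>_def)
  also have "\<dots> = (\<Sum>k<i. f k)" by (rule sum.nat_diff_reindex)
  also have "(\<Sum>j=i..<d. f (\<kappa> j)) = (\<Sum>k<d - i. f k)"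
    by (simp add: sum.atLeastLessThan_shift_0[of _ i d] \<kappa>_def atLeast0LessThan)
  also have "(\<Sum>k<i. f k) + (\<Sum>k<d - i. f k) \<le> 12 * r / (1 - r\<^sup>2) + 12 * r / (1 - r\<^sup>2)"
    unfolding f_def by (intro add_mono sum_odd_powers_le r)
  finally have sum: "(\<Sum>j<d. f (\<kappa> j)) \<le> 24 * r / (1 - r\<^sup>2)" by simp
  have "(\<Prod>j<d. z j + t i) \<le> (\<Prod>j<d. exp (f (\<kappa> j)) * \<bar>z j - t i\<bar>)"
    using factor z(3) t0[of i] by (intro prod_mono) (simp add: add_nonneg_nonneg less_imp_le)
  also have "\<dots> = exp (\<Sum>j<d. f (\<kappa> j)) * (\<Prod>j<d. \<bar>z j - t i\<bar>)"
    by (simp add: prod.distrib exp_sum)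
  also have "\<dots> \<le> exp (24 * r / (1 - r\<^sup>2)) * (\<Prod>j<d. \<bar>z j - t i\<bar>)"
    using sum by (intro mult_right_mono prod_nonneg) auto
  finally show ?thesis .
qed

text \<open>
  Let \<open>Z\<close> have its roots at the points \<open>- z j\<close>, where the \<open>z j\<close> interlace the \<open>t i\<close>. If \<open>P\<close> were
  this small at the points \<open>- t i\<close>, then the odd polynomial \<open>Z(-x) P(x) - Z(x) P(-x)\<close> would have
  the sign of \<open>Z(-x)\<close> at every \<open>t i\<close>, hence \<open>2d + 1\<close> roots.
\<close>

lemma reflected_values_not_small:
  fixes P :: "real poly" and t :: "nat \<Rightarrow> real"
  assumes r: "0 < r" "r < 1" and t0: "\<And>i. 0 < t i"
    and t: "\<And>i. i < d \<Longrightarrow> t i \<le> r\<^sup>2 * t (Suc i)" and deg: "degree P \<le> d"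
    and small: "\<And>i. i \<le> d \<Longrightarrow> exp (24 * r / (1 - r\<^sup>2)) * \<bar>poly P (- t i)\<bar> < poly P (t i)"
  shows False
proof -
  define K where "K = exp (24 * r / (1 - r\<^sup>2))"
  \<comment> \<open>The geometric mean splits the gap \<open>r^2\<close> evenly into two gaps
    \<open>r\<close>.\<close>
  define z where "z j = sqrt (t j * t (Suc j))" for j
  have z0: "0 < z j" for j using t0 by (simp add: z_def)
  have tz: "t j \<le> r * z j" if "j < d" for j
  proof -
    have "(t j)\<^sup>2 \<le> t j * (r\<^sup>2 * t (Suc j))"
      unfolding power2_eq_square[of "t j"] using t[OF that] t0[of j] by (intro mult_left_mono) auto
    also have "\<dots> = (r * z j)\<^sup>2" using t0[of j] t0[of "Suc j"] by (simp add: z_def power_mult_distrib)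
    finally show ?thesis using r z0[of j] by (intro power2_le_imp_le[of "t j"]) auto
  qed
  have zt: "z j \<le> r * t (Suc j)" if "j < d" for j
  proof -
    have "(z j)\<^sup>2 = t j * t (Suc j)" using t0[of j] t0[of "Suc j"] by (simp add: z_def)
    also have "\<dots> \<le> (r\<^sup>2 * t (Suc j)) * t (Suc j)"
      using t[OF that] t0[of "Suc j"] by (intro mult_right_mono) auto
    also have "\<dots> = (r * t (Suc j))\<^sup>2" by (simp add: power2_eq_square)
    finally show ?thesis using r t0[of "Suc j"] by (intro power2_le_imp_le[of "z j"]) auto
  qed
  have lt: "t j < z j" "z j < t (Suc j)" if "j < d" for j
  proof -
    have "r * z j < 1 * z j" "r * t (Suc j) < 1 * t (Suc j)"
      using r z0 t0 by (intro mult_strict_right_mono; simp)+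
    thus "t j < z j" "z j < t (Suc j)" using tz[OF that] zt[OF that] by linarith+
  qed
  have tmono: "t a \<le> t b" if "a \<le> b" "b \<le> d" for a b
    using that
  proof (induction b rule: dec_induct)
    case (step b)
    thus ?case using lt[of b] by simp
  qed simp
  define Z where "Z = (\<Prod>j<d. [:z j, 1:])"
  have Z: "poly Z x = (\<Prod>j<d. z j + x)" for x by (simp add: Z_def poly_prod)
  have degZ: "degree Z \<le> d" using degree_prod_linear_le[of "{..<d}" z] by (simp add: Z_def)
  define refl :: "real poly \<Rightarrow> real poly" where "refl q = pcompose q [:0, -1:]" for q
  have refl: "poly (refl q) x = poly q (- x)" "degree (refl q) \<le> degree q" for q x
    using degree_pcompose_le[of q "[:0,-1:]"] by (simp_all add: refl_def poly_pcompose)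
  define F where "F = refl Z * P - Z * refl P"
  have F: "poly F x = poly Z (- x) * poly P x - poly Z x * poly P (- x)" for x
    by (simp add: F_def refl)
  have bound: "poly Z (t i) \<le> K * \<bar>poly Z (- t i)\<bar>" if "i \<le> d" for i
    using interlacing_prod_bound[where t = t and z = z, OF r t0 t tz zt z0 that] by (simp add: Z K_def abs_prod)
  \<comment> \<open>The bounds \<open>Z(t) <= K |Z(-t)|\<close> and \<open>K |P(-t)| < P(t)\<close>
    make the first term of \<open>F\<close> dominate.\<close>
  have sgnF: "0 < poly F (t i) * poly Z (- t i)" if "i \<le> d" for i
  proof -
    define w where "w = poly Z (- t i)"
    have Zpos: "0 < poly Z (t i)" unfolding Z using z0 t0 by (intro prod_pos) (simp add: add_pos_pos)
    have w0: "0 < \<bar>w\<bar>" using bound[OF that] Zpos by (auto simp: w_def)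
    have "poly Z (t i) * \<bar>poly P (- t i)\<bar> \<le> (K * \<bar>w\<bar>) * \<bar>poly P (- t i)\<bar>"
      using bound[OF that] by (intro mult_right_mono) (auto simp: w_def)
    also have "\<dots> = \<bar>w\<bar> * (K * \<bar>poly P (- t i)\<bar>)" by simp
    also have "\<dots> < \<bar>w\<bar> * poly P (t i)"
      using small[OF that] w0 by (intro mult_strict_left_mono) (auto simp: K_def)
    finally have "\<bar>w\<bar> * (poly Z (t i) * \<bar>poly P (- t i)\<bar>) < \<bar>w\<bar> * (\<bar>w\<bar> * poly P (t i))"
      using w0 by (intro mult_strict_left_mono) auto
    moreover have "poly Z (t i) * poly P (- t i) * w \<le> \<bar>w\<bar> * (poly Z (t i) * \<bar>poly P (- t i)\<bar>)"
    proof -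
      have "poly Z (t i) * poly P (- t i) * w \<le> \<bar>poly Z (t i) * poly P (- t i) * w\<bar>" by (rule abs_ge_self)
      thus ?thesis using Zpos by (simp add: abs_mult mult_ac)
    qed
    moreover have "\<bar>w\<bar> * (\<bar>w\<bar> * poly P (t i)) = w * poly P (t i) * w"
      by (simp add: mult_ac flip: mult.assoc)
    ultimately show ?thesis by (simp add: F w_def[symmetric] left_diff_distrib)
  qed
  \<comment> \<open>Between \<open>t i\<close> and \<open>t (Suc i)\<close> only the root
    \<open>z i\<close> of \<open>Z(-x)\<close> is crossed.\<close>
  have altZ: "poly Z (- t i) * poly Z (- t (Suc i)) < 0" if i: "i < d" for i
  proof -
    have "0 < (z j - t i) * (z j - t (Suc i))" if j: "j < d" "j \<noteq> i" for j
    proof (cases "j < i")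
      case True
      have "z j < t i" "z j < t (Suc i)"
        using lt[OF j(1)] tmono[of "Suc j" i] tmono[of "Suc j" "Suc i"] True i by simp_all
      thus ?thesis by (intro mult_neg_neg) auto
    next
      case False
      hence "Suc i \<le> j" using j by simp
      hence "t i < z j" "t (Suc i) < z j"
        using lt[OF j(1)] tmono[of i j] tmono[of "Suc i" j] j by simp_all
      thus ?thesis by (intro mult_pos_pos) auto
    qed
    hence "0 < (\<Prod>j\<in>{..<d} - {i}. (z j - t i) * (z j - t (Suc i)))" by (intro prod_pos) auto
    moreover have "(z i - t i) * (z i - t (Suc i)) < 0"
      using lt[OF i] by (intro mult_pos_neg) auto
    moreover have "poly Z (- t i) * poly Z (- t (Suc i)) = (\<Prod>j<d. (z j - t i) * (z j - t (Suc i)))"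
      by (simp add: Z prod.distrib)
    ultimately show ?thesis using i by (simp add: prod.remove[of _ i] mult_neg_pos)
  qed
  show False
  proof (rule odd_poly_no_alternation[of F d t])
    show "poly F (- x) = - poly F x" for x by (simp add: F mult.commute)
    show "degree F \<le> 2 * d"
      unfolding F_def using degZ deg refl(2)[of Z] refl(2)[of P]
      by (intro degree_diff_le order_trans[OF degree_mult_le]) linarith+
    show "0 < t 0" by (rule t0)
    show "t i < t (Suc i)" if "i < d" for i using lt[OF that] by simp
    show "poly F (t i) * poly F (t (Suc i)) < 0" if "i < d" for i
    proof -
      have "0 < (poly F (t i) * poly Z (- t i)) * (poly F (t (Suc i)) * poly Z (- t (Suc i)))"
        using that by (intro mult_pos_pos[OF sgnF sgnF]) auto
      also have "\<dots> = (poly F (t i) * poly F (t (Suc i))) * (poly Z (- t i) * poly Z (- t (Suc i)))"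
        by (simp add: mult_ac)
      finally show ?thesis using altZ[OF that]
          zero_less_mult_iff[of "poly F (t i) * poly F (t (Suc i))" "poly Z (- t i) * poly Z (- t (Suc i))"]
        by linarith
    qed
    show "poly F (t 0) \<noteq> 0" using sgnF[of 0] by auto
  qed
qed

text \<open>With \<open>s = q(x) + q(-x)\<close>, an error \<open>e\<close> puts
  \<open>p(x) - p(-x)\<close> within \<open>e s\<close> of \<open>s\<close>. Hence
  \<open>|P(-x)| <= e s\<close>, while \<open>P(x) > s\<close>; an error below \<open>1/K\<close>
  would make the reflected values too small.\<close>

lemma Rplus_ge:
  fixes t :: "nat \<Rightarrow> nat"
  assumes r: "0 < r" "r < 1" and t0: "\<And>i. 0 < t i"
    and t: "\<And>i. i < d \<Longrightarrow> real (t i) \<le> r\<^sup>2 * real (t (Suc i))"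
    and tn: "\<And>i. i \<le> d \<Longrightarrow> t i \<le> n"
  shows "exp (- (24 * r / (1 - r\<^sup>2))) \<le> Rplus d (pm_set n)"
  unfolding Rplus_eq_Inf_rat_errors
proof (rule cInf_greatest[OF rat_errors_nonempty])
  fix e assume "e \<in> rat_errors d (pm_set n)"
  then obtain p q where e: "e = Max ((\<lambda>x. \<bar>sgn x - poly p x / poly q x\<bar>) ` pm_set n)"
    and deg: "degree p \<le> d" "degree q \<le> d" and q: "\<And>x. x \<in> pm_set n \<Longrightarrow> poly q x > 0"
    unfolding rat_errors_def by blast
  define K where "K = exp (24 * r / (1 - r\<^sup>2))"
  have r2: "0 < 1 - r\<^sup>2" using r by (simp add: power_less_one_iff)
  have K1: "1 \<le> K" unfolding K_def using r r2 by simp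
  have err: "\<bar>sgn x * poly q x - poly p x\<bar> \<le> e * poly q x" if "x \<in> pm_set n" for x
  proof -
    have "\<bar>sgn x - poly p x / poly q x\<bar> \<le> e"
      unfolding e using that finite_pm_set by (intro Max_ge) auto
    hence "\<bar>sgn x - poly p x / poly q x\<bar> * poly q x \<le> e * poly q x"
      using q[OF that] by (intro mult_right_mono) auto
    also have "\<bar>sgn x - poly p x / poly q x\<bar> * poly q x = \<bar>(sgn x - poly p x / poly q x) * poly q x\<bar>"
      using q[OF that] by (simp add: abs_mult)
    also have "(sgn x - poly p x / poly q x) * poly q x = sgn x * poly q x - poly p x"
      using q[OF that] by (simp add: left_diff_distrib)
    finally show ?thesis .
  qed
  show "exp (- (24 * r / (1 - r\<^sup>2))) \<le> e"
  proof (rule ccontr)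
    assume "\<not> ?thesis"
    hence "e < 1 / K" by (simp add: K_def exp_minus inverse_eq_divide)
    hence eK: "K * e < 1" using K1 by (simp add: field_simps)
    define P where "P = p - pcompose p [:0, -1:] + q + pcompose q [:0, -1:]"
    have P: "poly P x = poly p x - poly p (- x) + poly q x + poly q (- x)" for x
      by (simp add: P_def poly_pcompose)
    have "degree P \<le> d"
      unfolding P_def using deg degree_pcompose_le[of p "[:0,-1:]"] degree_pcompose_le[of q "[:0,-1:]"]
      by (intro degree_add_le degree_diff_le) auto
    moreover have "K * \<bar>poly P (- real (t i))\<bar> < poly P (real (t i))" if "i \<le> d" for i
    proof -
      define x where "x = real (t i)"
      have x: "0 < x" "x \<in> pm_set n" "- x \<in> pm_set n"
        using t0[of i] tn[OF that] by (auto simp: x_def mem_pm_set intro!: exI[of _ "t i"])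
      define s where "s = poly q x + poly q (- x)"
      have s: "0 < s" using q[OF x(2)] q[OF x(3)] by (simp add: s_def)
      have "\<bar>poly q x - poly p x\<bar> \<le> e * poly q x" "\<bar>- poly q (- x) - poly p (- x)\<bar> \<le> e * poly q (- x)"
        using err[OF x(2)] err[OF x(3)] x(1) by simp_all
      hence *: "\<bar>s - (poly p x - poly p (- x))\<bar> \<le> e * s"
        unfolding s_def distrib_left by linarith
      have Ks: "K * (e * s) < s" using eK s mult_strict_right_mono[of "K * e" 1 s] by simp
      \<comment> \<open>Nonnegativity of the error is read off from the bound on an absolute
        value.\<close>
      have "0 \<le> e * s" using * by linarith
      hence "e * s \<le> K * (e * s)" using K1 by (simp add: mult_le_cancel_right1)
      hence es: "e * s < s" using Ks by linarith
      have "\<bar>poly P (- x)\<bar> \<le> e * s" using * by (simp add: P s_def)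
      hence "K * \<bar>poly P (- x)\<bar> \<le> K * (e * s)" using K1 by (intro mult_left_mono) auto
      moreover have "s < poly P x" using * es s unfolding P s_def by linarith
      ultimately show ?thesis using Ks by (simp add: x_def)
    qed
    ultimately show False
      using reflected_values_not_small[of r "\<lambda>i. real (t i)" d P] r t0 t by (simp add: K_def)
  qed
qed

section \<open>Lower bound for small degrees\<close>

lemma Rplus_ge_small_degree:
  assumes n: "1 \<le> n" and d: "1 \<le> d" "real d \<le> log 2 (real n)"
  shows "exp (- (96 * (1 / real n powr (1 / (2 * real d))))) \<le> Rplus d (pm_set n)"
proof -
  define s where "s = real n powr (1 / real d)"
  have "2 powr real d \<le> real n" using n d by (simp add: le_log_iff)
  hence "(2 powr real d) powr (1 / real d) \<le> s" unfolding s_def by (intro powr_mono2) auto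
  hence s2: "2 \<le> s" using d by (simp add: powr_powr)
  have sd: "s ^ d = real n" unfolding s_def using n d by (simp add: powr_power)
  \<comment> \<open>Rounding down makes the points \<open>D^i\<close> integers and keeps them at
    most \<open>s^d = n\<close>. As \<open>s >= 2\<close>, it loses at most a factor 2.\<close>
  define D where "D = nat \<lfloor>s\<rfloor>"
  have D: "2 \<le> D" "real D \<le> s" "s \<le> 2 * real D"
  proof -
    have fl: "2 \<le> \<lfloor>s\<rfloor>" using s2 by (simp add: le_floor_iff)
    thus D2: "2 \<le> D" unfolding D_def by linarith
    have D': "real D = of_int \<lfloor>s\<rfloor>" using fl by (simp add: D_def)
    thus "real D \<le> s" by simp
    have "s < real D + 1" unfolding D' by linarith
    thus "s \<le> 2 * real D" using D2 by simp
  qed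
  define r where "r = 1 / sqrt (real D)"
  have r2: "r\<^sup>2 = 1 / real D" using D by (simp add: r_def power_divide)
  have r: "0 < r" "r < 1" using D by (simp_all add: r_def)
  have "exp (- (24 * r / (1 - r\<^sup>2))) \<le> Rplus d (pm_set n)"
  proof (rule Rplus_ge[OF r, of "\<lambda>i. D ^ i"])
    show "0 < D ^ i" for i using D by simp
    show "real (D ^ i) \<le> r\<^sup>2 * real (D ^ Suc i)" for i using D by (simp add: r2)
    fix i assume "i \<le> d"
    hence "real D ^ i \<le> real D ^ d" using D by (intro power_increasing) auto
    also have "\<dots> \<le> s ^ d" using D by (intro power_mono) auto
    finally have "real (D ^ i) \<le> real n" unfolding sd by simp
    thus "D ^ i \<le> n" by (simp only: of_nat_le_iff)
  qed
  moreover have "24 * r / (1 - r\<^sup>2) \<le> 96 * (1 / real n powr (1 / (2 * real d)))"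
  proof -
    have "sqrt s = real n powr (1 / (2 * real d))"
      using n by (simp add: s_def powr_powr mult.commute flip: powr_half_sqrt)
    moreover have "sqrt s \<le> 2 * sqrt (real D)"
    proof (rule real_le_lsqrt)
      show "s \<le> (2 * sqrt (real D))\<^sup>2" using D by (simp add: power_mult_distrib)
    qed (use s2 in auto)
    moreover have "0 < sqrt s" "0 < sqrt (real D)" using s2 D by simp_all
    ultimately have rn: "r \<le> 2 * (1 / real n powr (1 / (2 * real d)))"
      by (simp add: r_def field_simps)
    \<comment> \<open>\<open>D >= 2\<close> doubles 24 to 48, and \<open>r <= 2 / sqrt s\<close>
      doubles it again to 96.\<close>
    have "1 / real D \<le> 1 / 2" using D by (intro divide_left_mono) auto
    hence "1 / 2 \<le> 1 - r\<^sup>2" by (simp add: r2)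
    hence "24 * r / (1 - r\<^sup>2) \<le> 24 * r / (1 / 2)" using r by (intro divide_left_mono) auto
    thus ?thesis using rn by simp
  qed
  ultimately show ?thesis by (meson exp_le_cancel_iff neg_le_iff_le order_trans)
qed

section \<open>Lower bounds from integer points with ratios at least \<open>1 + 1/h\<close>\<close>

lemma Rplus_ge_ratio:
  fixes t :: "nat \<Rightarrow> nat"
  assumes h: "1 \<le> h" and t0: "\<And>i. 0 < t i"
    and t: "\<And>i. i < d \<Longrightarrow> (h + 1) * t i \<le> h * t (Suc i)"
    and tn: "\<And>i. i \<le> d \<Longrightarrow> t i \<le> n"
  shows "exp (- (48 * real h)) \<le> Rplus d (pm_set n)"
proof -
  define r where "r = sqrt (real h / (real h + 1))"
  have r2: "r\<^sup>2 = real h / (real h + 1)" by (simp add: r_def)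
  have r: "0 < r" "r < 1" using h by (simp_all add: r_def)
  have "exp (- (24 * r / (1 - r\<^sup>2))) \<le> Rplus d (pm_set n)"
  proof (rule Rplus_ge[OF r t0 _ tn])
    fix i assume "i < d"
    have "real ((h + 1) * t i) \<le> real (h * t (Suc i))" using t[OF \<open>i < d\<close>] by (simp only: of_nat_le_iff)
    thus "real (t i) \<le> r\<^sup>2 * real (t (Suc i))" by (simp add: r2 field_simps)
  qed auto
  moreover have "24 * r / (1 - r\<^sup>2) \<le> 48 * real h"
  proof -
    \<comment> \<open>Here \<open>r < 1\<close> and \<open>h + 1 <= 2h\<close> turn 24 into
      48.\<close>
    have "1 - r\<^sup>2 = 1 / (real h + 1)" unfolding r2 by (simp add: field_simps)
    hence "24 * r / (1 - r\<^sup>2) = r * (24 * (real h + 1))" by simp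
    also have "\<dots> \<le> 1 * (24 * (real h + 1))" using r by (intro mult_right_mono) auto
    also have "\<dots> \<le> 48 * real h" using h by simp
    finally show ?thesis .
  qed
  ultimately show ?thesis by (meson exp_le_cancel_iff neg_le_iff_le order_trans)
qed

text \<open>The points are \<open>1, ..., d + 1\<close>, with least ratio
  \<open>(d + 1) / d\<close>.\<close>

lemma Rplus_ge_consecutive:
  assumes "1 \<le> d" "d < n"
  shows "exp (- (48 * real d)) \<le> Rplus d (pm_set n)"
  using assms by (intro Rplus_ge_ratio[of d Suc]) auto

text \<open>The increment is the ceiling of the current term over \<open>h\<close>, the least
  integer increment giving a ratio of at least \<open>1 + 1/h\<close>.\<close>

primrec sparse_seq :: "nat \<Rightarrow> nat \<Rightarrow> nat" where
  "sparse_seq h 0 = 1"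
| "sparse_seq h (Suc k) = sparse_seq h k + (sparse_seq h k + h - 1) div h"

lemma ceiling_div_bounds:
  fixes a h :: nat
  assumes "1 \<le> h"
  shows "a \<le> h * ((a + h - 1) div h)" "h * ((a + h - 1) div h) \<le> a + h"
proof -
  have "h * ((a + h - 1) div h) + (a + h - 1) mod h = a + h - 1" by simp
  moreover have "(a + h - 1) mod h < h" using assms by simp
  ultimately show "a \<le> h * ((a + h - 1) div h)" "h * ((a + h - 1) div h) \<le> a + h"
    using assms by linarith+
qed

text \<open>Adding \<open>h\<close> to each term absorbs the rounding: the shifted terms grow by at
  most the factor \<open>1 + 1/h\<close>, starting from
  \<open>1 + h = h * (1 + 1/h)\<close>.\<close>

lemma sparse_seq_le:
  assumes "1 \<le> h"
  shows "real (sparse_seq h k) + real h \<le> real h * (1 + 1 / real h) ^ Suc k"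
proof (induction k)
  case 0
  thus ?case using assms by (simp add: field_simps)
next
  case (Suc k)
  define a q where "a = sparse_seq h k" and "q = (sparse_seq h k + h - 1) div h"
  have "real (h * q) \<le> real (a + h)"
    using ceiling_div_bounds(2)[OF assms, of a] by (simp only: of_nat_le_iff a_def q_def)
  hence "real q \<le> real a / real h + 1" using assms by (simp add: field_simps)
  hence "real (a + q) + real h \<le> (real a + real h) * (1 + 1 / real h)"
    using assms by (simp add: algebra_simps add_divide_distrib)
  also have "\<dots> \<le> real h * (1 + 1 / real h) ^ Suc k * (1 + 1 / real h)"
    using Suc.IH by (intro mult_right_mono) (auto simp: a_def)
  finally show ?case by (simp add: a_def q_def mult_ac)
qed

lemma Rplus_ge_sparse:
  assumes h: "1 \<le> h" and n: "real h * (1 + 1 / real h) ^ Suc d \<le> real n"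
  shows "exp (- (48 * real h)) \<le> Rplus d (pm_set n)"
proof (rule Rplus_ge_ratio[OF h, of "sparse_seq h"])
  show "0 < sparse_seq h i" for i by (induction i) auto
  show "(h + 1) * sparse_seq h i \<le> h * sparse_seq h (Suc i)" for i
    using ceiling_div_bounds(1)[OF h, of "sparse_seq h i"] by (simp add: algebra_simps)
  fix i assume "i \<le> d"
  have "real (sparse_seq h i) \<le> real h * (1 + 1 / real h) ^ Suc i"
    using sparse_seq_le[OF h, of i] by linarith
  also have "\<dots> \<le> real h * (1 + 1 / real h) ^ Suc d"
    using \<open>i \<le> d\<close> by (intro mult_left_mono power_increasing) auto
  also note n
  finally show "sparse_seq h i \<le> n" by simp
qed

section \<open>The range of large degrees\<close>

text \<open>Here \<open>L = 1 + log n - log d\<close>. So \<open>d < n\<close> gives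
  \<open>L > 1\<close>, and \<open>d >= 2\<close> gives \<open>L <= log n < d\<close>.\<close>

lemma log_ratio_bounds:
  assumes d: "1 \<le> d" "log 2 (real n) < real d" "d < n"
  defines "L \<equiv> log 2 (2 * real n / real d)"
  shows "2 \<le> d" "1 < L" "L \<le> real d"
proof -
  show d2: "2 \<le> d"
  proof (rule ccontr)
    assume "\<not> 2 \<le> d"
    hence "d = 1" "2 \<le> n" using d by auto
    hence "log 2 2 \<le> log 2 (real n)" by (subst log_le_cancel_iff) auto
    thus False using d \<open>d = 1\<close> by simp
  qed
  have L: "L = 1 + log 2 (real n) - log 2 (real d)"
    using d by (simp add: L_def log_divide log_mult)
  have "log 2 (real d) < log 2 (real n)" using d by (subst log_less_cancel_iff) auto
  thus "1 < L" by (simp add: L)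
  have "1 \<le> log 2 (real d)" using d2 by simp
  thus "L \<le> real d" using d(2) unfolding L by linarith
qed

lemma Rplus_ge_large_degree:
  assumes d: "1 \<le> d" "log 2 (real n) < real d" "d < n"
  shows "exp (- (336 * (real d / log 2 (2 * real n / real d)))) \<le> Rplus d (pm_set n)"
proof -
  define Y where "Y = 2 * real n / real d"
  define L where "L = log 2 Y"
  have L: "2 \<le> d" "1 < L" "L \<le> real d" using log_ratio_bounds[OF d] by (simp_all add: L_def Y_def)
  have Y: "0 < Y" "real n = real d * Y / 2" using d by (simp_all add: Y_def)
  have "\<exists>h. real h \<le> 7 * (real d / L) \<and> exp (- (48 * real h)) \<le> Rplus d (pm_set n)"
  proof (cases "L < 4")
    \<comment> \<open>For bounded \<open>n/d\<close> consecutive integers lose only a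
      constant.\<close>
    case True
    have "L * real d \<le> 7 * real d" using True by (intro mult_right_mono) auto
    hence "real d \<le> 7 * (real d / L)" using L by (simp add: field_simps)
    thus ?thesis using Rplus_ge_consecutive[OF d(1,3)] by blast
  next
    case False
    \<comment> \<open>Chosen so that \<open>(d + 1) / h <= L / 4\<close>, which keeps the total
      growth below \<open>exp (L / 4) <= 2 powr (L / 2)\<close>.\<close>
    define h where "h = nat \<lceil>4 * (real d + 1) / L\<rceil>"
    have x0: "0 < 4 * (real d + 1) / L" using L by simp
    have h1: "4 * (real d + 1) / L \<le> real h" unfolding h_def by (rule of_nat_ceiling)
    have h2: "real h \<le> 4 * (real d + 1) / L + 1"
      using x0 unfolding h_def by linarith
    have h: "1 \<le> h" using h1 x0 by (cases h) auto
    have "4 * (real d + 1) / L + 1 \<le> (6 * real d + L) / L"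
      using L by (simp add: field_simps)
    also have "\<dots> \<le> (7 * real d) / L" using L by (intro divide_right_mono) auto
    finally have h7: "real h \<le> 7 * (real d / L)" using h2 by simp
    have "(1 + 1 / real h) ^ Suc d \<le> exp (1 / real h) ^ Suc d"
      by (intro power_mono) auto
    also have "\<dots> = exp (real (Suc d) * (1 / real h))" by (rule exp_of_nat_mult[symmetric])
    also have "\<dots> \<le> exp (1 / 2 * (L / 2))"
    proof -
      have "4 * (real d + 1) \<le> real h * L" using h1 L by (simp add: field_simps)
      thus ?thesis using h by (simp add: field_simps)
    qed
    also have "\<dots> = exp (1 / 2) powr (L / 2)" by (simp add: powr_def)
    also have "\<dots> \<le> 2 powr (L / 2)" using L exp_half_le2 by (intro powr_mono2) auto
    finally have pow: "(1 + 1 / real h) ^ Suc d \<le> 2 powr (L / 2)" .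
    define y where "y = 2 powr (L / 2)"
    have "y * y = 2 powr L" unfolding y_def by (simp flip: powr_add)
    hence yY: "y * y = Y" using Y by (simp add: L_def)
    have "2 powr 2 \<le> y" unfolding y_def using False by (intro powr_mono) auto
    hence y4: "4 \<le> y" by simp
    \<comment> \<open>Since \<open>h <= 2d\<close>, \<open>y >= 4\<close> and
      \<open>y^2 = Y\<close>, the last point is at most \<open>2 d y <= d Y / 2 = n\<close>.\<close>
    have "real d * 7 \<le> real d * (2 * L)" using False by (intro mult_left_mono) auto
    hence "7 * (real d / L) \<le> 2 * real d" using L by (simp add: field_simps)
    hence "real h * (1 + 1 / real h) ^ Suc d \<le> (2 * real d) * y"
      using pow h7 by (intro mult_mono) (auto simp: y_def)
    also have "\<dots> \<le> (2 * real d) * (y * y / 4)" using y4 by (intro mult_left_mono) auto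
    also have "\<dots> = real n" by (simp add: yY Y)
    finally show ?thesis using Rplus_ge_sparse[OF h] h7 by blast
  qed
  then obtain h where h: "real h \<le> 7 * (real d / L)" "exp (- (48 * real h)) \<le> Rplus d (pm_set n)"
    by blast
  have "exp (- (336 * (real d / L))) \<le> exp (- (48 * real h))" using h(1) by simp
  also note h(2)
  finally show ?thesis by (simp only: L_def Y_def)
qed

lemma Rplus_le_large_degree:
  assumes d: "1 \<le> d" "log 2 (real n) < real d" "d < n"
  shows "Rplus d (pm_set n) \<le> exp (- (1 / 36 * (real d / log 2 (2 * real n / real d))))"
proof -
  define L where "L = log 2 (2 * real n / real d)"
  have L: "2 \<le> d" "1 < L" "L \<le> real d" using log_ratio_bounds[OF d] by (simp_all add: L_def)
  show ?thesis
  proof (cases "real d / L < 12")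
    \<comment> \<open>The exponent to be reached is less than 1/3 in size, so the constant bound 1/3
      from geometric roots suffices.\<close>
    case True
    define s where "s = real n powr (1 / real d)"
    have s: "Rplus d (pm_set n) \<le> (s - 1) / (s + 1)" "1 < s"
      using Rplus_le_geometric[of n d] d by (simp_all add: s_def)
    have "real n \<le> 2 powr real d"
      using less_imp_le[OF d(2)] d(3) by (subst (asm) log_le_iff) auto
    hence "s \<le> (2 powr real d) powr (1 / real d)" unfolding s_def by (intro powr_mono2) auto
    hence s2: "s \<le> 2" using d by (simp add: powr_powr)
    note s(1)
    also have "(s - 1) / (s + 1) \<le> 1 / 3" using s s2 by (simp add: field_simps)
    also have "\<dots> \<le> exp (- 1)" using exp_le by (simp add: exp_minus inverse_eq_divide divide_simps)
    also have "\<dots> \<le> exp (- (1 / 36 * (real d / L)))" using True by simp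
    finally show ?thesis by (simp add: L_def)
  next
    case False
    \<comment> \<open>Half the degree goes to the smallest points; \<open>J\<close> dyadic scales
      reach from \<open>h\<close> to \<open>n\<close>.\<close>
    define h J where "h = d div 2" and "J = nat \<lceil>log 2 (real n / real h)\<rceil>"
    have "h + h \<le> d" "d \<le> 3 * h" "1 \<le> h" using L by (auto simp: h_def)
    hence h: "1 \<le> h" "h < n" "real d \<le> 3 * real h" "2 * real h \<le> real d" using d by auto
    have lg0: "0 < log 2 (real n / real h)" using h by simp
    have J1: "log 2 (real n / real h) \<le> real J" unfolding J_def by (rule of_nat_ceiling)
    have J2: "real J \<le> log 2 (real n / real h) + 1" using lg0 unfolding J_def by linarith
    have J0: "1 \<le> J" using lg0 J1 by (cases J) auto
    have "real n / real h \<le> 2 powr real J" using J1 h by (simp add: log_le_iff)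
    hence "real n \<le> real (h * 2 ^ J)" using h by (simp add: powr_realpow field_simps)
    hence nJ: "n \<le> h * 2 ^ J" by (simp only: of_nat_le_iff)
    have "real n * real d \<le> real n * (4 * real h)" using h by (intro mult_left_mono) auto
    hence "real n / real h \<le> 2 * (2 * real n / real d)" using h d by (simp add: field_simps)
    hence "log 2 (real n / real h) \<le> log 2 (2 * (2 * real n / real d))"
      using h d by (subst log_le_cancel_iff) auto
    also have "\<dots> = 1 + L" unfolding L_def using d by (subst log_mult) auto
    finally have J3: "real J \<le> 3 * L" using J2 L by linarith
    define k where "k = (d - h) div J"
    have "J * k + (d - h) mod J = d - h" by (simp add: k_def)
    moreover have "(d - h) mod J < J" using J0 by simp
    ultimately have Jk: "h + k * J \<le> d" and "d - h \<le> J * (k + 1)"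
      using h by (simp_all add: algebra_simps)
    hence "real (d - h) \<le> real (J * (k + 1))" by (simp only: of_nat_le_iff)
    hence "real d / 2 \<le> real J * (real k + 1)" using h by (simp add: of_nat_diff algebra_simps)
    also have "\<dots> \<le> 3 * L * (real k + 1)" using J3 by (intro mult_right_mono) auto
    finally have "real d / L \<le> 6 * (real k + 1)" using L by (simp add: field_simps)
    \<comment> \<open>Since \<open>d / L >= 12\<close>, the rounding term 6 is at most half of
      \<open>d / L\<close>.\<close>
    hence k12: "real d / L \<le> 12 * real k" and "1 \<le> real k"
      using False unfolding not_less distrib_left by linarith+
    hence k1: "1 \<le> k" by simp
    have "Rplus d (pm_set n) \<le> 2 * (1 / 3) ^ k"
      using h nJ J0 k1 Jk by (intro Rplus_le_dyadic) auto
    \<comment> \<open>The factor 2 is absorbed using \<open>k >= 1\<close>.\<close>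
    also have "\<dots> \<le> 2 ^ k * (1 / 3) ^ k"
      using power_increasing[OF k1, of "2::real"] by (intro mult_right_mono) auto
    also have "\<dots> = (2 / 3) ^ k" by (simp flip: power_mult_distrib)
    also have "\<dots> \<le> exp (- 1 / 3) ^ k"
      using exp_ge_add_one_self[of "- 1 / 3 :: real"] by (intro power_mono) auto
    also have "\<dots> = exp (real k * (- 1 / 3))" by (rule exp_of_nat_mult[symmetric])
    also have "\<dots> \<le> exp (- (1 / 36 * (real d / L)))" using k12 by simp
    finally show ?thesis by (simp add: L_def)
  qed
qed

theorem theorem5p1:
  "(\<exists>c1>0. \<exists>c2>0. \<forall>n d :: nat. 1 \<le> n \<longrightarrow> 1 \<le> d \<longrightarrow> real d \<le> log 2 (real n) \<longrightarrow>
            (\<exists>\<theta>. c1 * (1 / real n powr (1 / (2 * real d))) \<le> \<theta> \<and>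
                 \<theta> \<le> c2 * (1 / real n powr (1 / (2 * real d))) \<and>
                 exp (- \<theta>) \<le> Rplus d (pm_set n)))
  \<and> (\<forall>n d :: nat. 1 \<le> n \<longrightarrow> 1 \<le> d \<longrightarrow> real d \<le> log 2 (real n) \<longrightarrow>
            Rplus d (pm_set n) < exp (- (1 / real n powr (1 / real d))))
  \<and> (\<exists>c1>0. \<exists>c2>0. \<forall>n d :: nat. 1 \<le> n \<longrightarrow> 1 \<le> d \<longrightarrow> log 2 (real n) < real d \<longrightarrow> d < n \<longrightarrow>
            (\<exists>\<theta>. c1 * (real d / log 2 (2 * real n / real d)) \<le> \<theta> \<and>
                 \<theta> \<le> c2 * (real d / log 2 (2 * real n / real d)) \<and>
                 Rplus d (pm_set n) = exp (- \<theta>)))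
  \<and> (\<forall>n d :: nat. 1 \<le> n \<longrightarrow> 1 \<le> d \<longrightarrow> n \<le> d \<longrightarrow> Rplus d (pm_set n) = 0)"
proof (intro conjI allI impI)
  show "\<exists>c1>0. \<exists>c2>0. \<forall>n d :: nat. 1 \<le> n \<longrightarrow> 1 \<le> d \<longrightarrow> real d \<le> log 2 (real n) \<longrightarrow>
            (\<exists>\<theta>. c1 * (1 / real n powr (1 / (2 * real d))) \<le> \<theta> \<and>
                 \<theta> \<le> c2 * (1 / real n powr (1 / (2 * real d))) \<and>
                 exp (- \<theta>) \<le> Rplus d (pm_set n))"
    \<comment> \<open>Both constants are 96, so \<theta> is exactly the exponent of the lower
      bound.\<close>
    using Rplus_ge_small_degree by (intro exI[of _ "96::real"] conjI) auto
next
  fix n d :: nat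
  assume n: "1 \<le> n" and d: "1 \<le> d" "real d \<le> log 2 (real n)"
  \<comment> \<open>For \<open>n = 1\<close> the logarithm is 0, below \<open>d\<close>.\<close>
  have "n \<noteq> 1" using d by auto
  thus "Rplus d (pm_set n) < exp (- (1 / real n powr (1 / real d)))"
    using n d by (intro Rplus_less_exp) auto
next
  have "\<exists>\<theta>. 1 / 36 * (real d / log 2 (2 * real n / real d)) \<le> \<theta> \<and>
          \<theta> \<le> 336 * (real d / log 2 (2 * real n / real d)) \<and> Rplus d (pm_set n) = exp (- \<theta>)"
    if d: "1 \<le> d" "log 2 (real n) < real d" "d < n" for n d
  proof -
    note lower = Rplus_ge_large_degree[OF d] and upper = Rplus_le_large_degree[OF d]
    \<comment> \<open>Positivity lets \<theta> be defined through \<open>ln\<close>.\<close>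
    have pos: "0 < Rplus d (pm_set n)" using less_le_trans[OF exp_gt_zero lower] .
    define \<theta> where "\<theta> = - ln (Rplus d (pm_set n))"
    have \<theta>: "Rplus d (pm_set n) = exp (- \<theta>)" using pos by (simp add: \<theta>_def)
    show ?thesis using lower upper unfolding \<theta> exp_le_cancel_iff by (intro exI[of _ \<theta>]) simp
  qed
  thus "\<exists>c1>0. \<exists>c2>0. \<forall>n d :: nat. 1 \<le> n \<longrightarrow> 1 \<le> d \<longrightarrow> log 2 (real n) < real d \<longrightarrow> d < n \<longrightarrow>
            (\<exists>\<theta>. c1 * (real d / log 2 (2 * real n / real d)) \<le> \<theta> \<and>
                 \<theta> \<le> c2 * (real d / log 2 (2 * real n / real d)) \<and>
                 Rplus d (pm_set n) = exp (- \<theta>))"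
    by (intro exI[of _ "1 / 36 :: real"] exI[of _ "336::real"] conjI) auto
next
  fix n d :: nat
  assume "1 \<le> n" "n \<le> d"
  thus "Rplus d (pm_set n) = 0" by (rule Rplus_eq_0)
qed

end
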